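(* Let $\mathcal X\subset\mathbb R^n$, let $g$ and $h_1,\dots,h_k$ be real-valued $C^\infty$ functions of $(x,y)\in\mathcal X\times\mathbb R^m$, and let $\mathcal Y(x)=\{y\in\mathbb R^m: h_i(x,y)\le 0,\ i=1,\dots,k\}$ be nonempty for every $x\in\mathcal X$. Fix $x\in\mathcal X$. Suppose $\mathcal Y(x)$ is bounded, each $h_i(x,\cdot)$ is convex, $g(x,\cdot)$ is strongly convex, and LICQ and SCSC hold for the lower-level problem $\min_{y\in\mathcal Y(x)}g(x,y)$ at $x$. Let $y^\ast(x)$ be its unique global minimizer and $\mathcal J(x,y^\ast(x))=\{i:h_i(x,y^\ast(x))=0\}$ its active index set. Then for any compact sets $K_{\rm in},K_{\rm out}\subset\mathbb R^m$ with $\mathcal Y(x)\subset\operatorname{int}(K_{\rm in})$ and $K_{\rm in}\subset\operatorname{int}(K_{\rm out})$ there exists $\epsilon=\epsilon(x,K_{\rm in},K_{\rm out})>0$ such that for any $C^2$ perturbations $s(x,\cdot)$ and $r_i(x,\cdot)$, $i=1,\dots,k$, with $$\|s(x,\cdot)\|_{C^2(K_{\rm out})}+\max_i\|r_i(x,\cdot)\|_{C^2(K_{\rm out})}\le\epsilon,$$ the perturbed problem restricted to $K_{\rm in}$, i.e. minimizing $\widetilde g(x,y)=g(x,y)+s(x,y)$ over $\{y\in K_{\rm in}:\widetilde h_i(x,y)=h_i(x,y)+r_i(x,y)\le 0,\ i=1,\dots,k\}$, has a unique minimizer $\widetilde y^\ast(x)$, and $\{i:\widetilde h_i(x,\widetilde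 y^\ast(x))=0\}=\mathcal J(x,y^\ast(x))$.
   Context: KKT pair at $x$: $(y,\lambda)\in\mathbb R^m\times\mathbb R^k$ with $\nabla_y g(x,y)+\sum_i\lambda_i\nabla_y h_i(x,y)=0$, $h_i(x,y)\le 0$, $\lambda_i\ge 0$, $\lambda_i h_i(x,y)=0$ for all $i$. LICQ holds at $x$ if for every $y\in\mathcal Y(x)$ the vectors $\{\nabla_y h_i(x,y): h_i(x,y)=0\}$ are linearly independent. SCSC holds at $x$ if for every KKT pair $(y^\ast,\lambda^\ast)$ at $x$ and every $i$, either $h_i(x,y^\ast)<0$ and $\lambda^\ast_i=0$, or $h_i(x,y^\ast)=0$ and $\lambda^\ast_i>0$. Compact-local norm: for compact $K\subset\mathbb R^m$ and $\phi$ of class $C^2$ near $K$, $\|\phi\|_{C^2(K)}=\max\{\sup_{K}|\phi|,\ \sup_{K}\|\nabla\phi\|,\ \sup_{K}\|\nabla^2\phi\|_{\rm op}\}$; for $\phi(x,y)$ it is taken in $y$ with $x$ fixed. *)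

theory Defs
  imports "HOL-Analysis.Analysis"
begin

subsection \<open>Differentiability classes\<close>

text \<open>
  \<open>Ck_on k f U\<close> says that \<open>f\<close> is of class \<open>C\<^sup>k\<close>; it is meant for open \<open>U\<close> only.
  Higher derivatives are taken through the directional derivatives, so that the codomain does
  not change along the recursion; in finite dimension this is the usual notion.
\<close>

primrec Ck_on ::
  "nat \<Rightarrow> ('a::euclidean_space \<Rightarrow> 'b::real_normed_vector) \<Rightarrow> 'a set \<Rightarrow> bool" where
  "Ck_on 0 f U \<longleftrightarrow> continuous_on U f"
| "Ck_on (Suc k) f U \<longleftrightarrow>
     (\<forall>z\<in>U. f differentiable at z) \<and>
     (\<forall>v. Ck_on k (\<lambda>z. frechet_derivative f (at z) v) U)"

text \<open>
  Smoothness on an arbitrary, not necessarily open, set: near every point of \<open>S\<close> the function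
  agrees on \<open>S\<close> with a \<open>C\<^sup>\<infinity>\<close> function defined on an open set.
\<close>

definition smooth_on ::
  "'a::euclidean_space set \<Rightarrow> ('a \<Rightarrow> 'b::real_normed_vector) \<Rightarrow> bool" where
  "smooth_on S f \<longleftrightarrow>
     (\<forall>z\<in>S. \<exists>U F. open U \<and> z \<in> U \<and> (\<forall>k. Ck_on k F U) \<and> (\<forall>w\<in>S \<inter> U. F w = f w))"

definition C2_near :: "'a::euclidean_space set \<Rightarrow> ('a \<Rightarrow> real) \<Rightarrow> bool" where
  "C2_near K f \<longleftrightarrow> (\<exists>U. open U \<and> K \<subseteq> U \<and> Ck_on 2 f U)"

definition gradient :: "('a::real_inner \<Rightarrow> real) \<Rightarrow> 'a \<Rightarrow> 'a" where
  "gradient f y = (THE D. GDERIV f y :> D)"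

lemma gradient_eqI: "GDERIV f y :> D \<Longrightarrow> gradient f y = D"
  unfolding gradient_def gderiv_def
  by (rule the_equality, assumption)
     (metis has_derivative_unique inner_commute vector_eq_rdot)

definition hessian :: "('a::real_inner \<Rightarrow> real) \<Rightarrow> 'a \<Rightarrow> 'a \<Rightarrow> 'a" where
  "hessian f y = frechet_derivative (gradient f) (at y)"

text \<open>Meaningful for nonempty compact \<open>K\<close> and \<open>f\<close> of class \<open>C\<^sup>2\<close> near \<open>K\<close>.\<close>

definition C2_norm :: "'a::real_inner set \<Rightarrow> ('a \<Rightarrow> real) \<Rightarrow> real" where
  "C2_norm K f =
     Max {SUP y\<in>K. \<bar>f y\<bar>, SUP y\<in>K. norm (gradient f y), SUP y\<in>K. onorm (hessian f y)}"

definition strongly_convex :: "('a::real_inner \<Rightarrow> real) \<Rightarrow> bool" where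
  "strongly_convex f \<longleftrightarrow>
     (\<exists>\<mu>>0. \<forall>y z. \<forall>t\<in>{0..1}.
        f ((1 - t) *\<^sub>R y + t *\<^sub>R z)
          \<le> (1 - t) * f y + t * f z - \<mu> / 2 * t * (1 - t) * (norm (y - z))\<^sup>2)"

subsection \<open>Parametric constrained minimization\<close>

definition feasible :: "('k \<Rightarrow> 'x \<Rightarrow> 'y \<Rightarrow> real) \<Rightarrow> 'x \<Rightarrow> 'y set" where
  "feasible h x = {y. \<forall>i. h i x y \<le> 0}"

definition active :: "('k \<Rightarrow> 'x \<Rightarrow> 'y \<Rightarrow> real) \<Rightarrow> 'x \<Rightarrow> 'y \<Rightarrow> 'k set" where
  "active h x y = {i. h i x y = 0}"

definition unique_minimizer :: "('y \<Rightarrow> real) \<Rightarrow> 'y set \<Rightarrow> 'y \<Rightarrow> bool" where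
  "unique_minimizer f S y \<longleftrightarrow>
     is_arg_min f (\<lambda>z. z \<in> S) y \<and> (\<forall>z. is_arg_min f (\<lambda>z. z \<in> S) z \<longrightarrow> z = y)"

definition kkt_pair ::
  "('x \<Rightarrow> 'y \<Rightarrow> real) \<Rightarrow> ('k::finite \<Rightarrow> 'x \<Rightarrow> 'y \<Rightarrow> real) \<Rightarrow> 'x \<Rightarrow> 'y::real_inner \<Rightarrow> real ^ 'k \<Rightarrow> bool"
where
  "kkt_pair g h x y l \<longleftrightarrow>
     gradient (g x) y + (\<Sum>i\<in>UNIV. l $ i *\<^sub>R gradient (h i x) y) = 0 \<and>
     (\<forall>i. h i x y \<le> 0 \<and> l $ i \<ge> 0 \<and> l $ i * h i x y = 0)"

text \<open>
  Linear independence is that of the family of active gradients, hence the injectivity: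
  two distinct active constraints with equal gradients violate LICQ.
\<close>

definition LICQ :: "('k \<Rightarrow> 'x \<Rightarrow> 'y::real_inner \<Rightarrow> real) \<Rightarrow> 'x \<Rightarrow> bool"
where
  "LICQ h x \<longleftrightarrow>
     (\<forall>y\<in>feasible h x.
        inj_on (\<lambda>i. gradient (h i x) y) (active h x y) \<and>
        independent ((\<lambda>i. gradient (h i x) y) ` active h x y))"

definition SCSC ::
  "('x \<Rightarrow> 'y \<Rightarrow> real) \<Rightarrow> ('k::finite \<Rightarrow> 'x \<Rightarrow> 'y::real_inner \<Rightarrow> real) \<Rightarrow> 'x \<Rightarrow> bool" where
  "SCSC g h x \<longleftrightarrow>
     (\<forall>y l. kkt_pair g h x y l \<longrightarrow>
        (\<forall>i. h i x y < 0 \<and> l $ i = 0 \<or> h i x y = 0 \<and> l $ i > 0))"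

end

(*
  No implicit function theorem and no multipliers of the perturbed problem are needed.
  By compactness and a Slater point, perturbed minimizers lie near the minimizer y* once the
  perturbation is small.  Strict complementarity (all active multipliers positive) together with
  LICQ gives, for every active index j, a direction along which g strictly decreases and all other
  active constraints strictly decrease; this persists under C1-small perturbations, so a perturbed
  minimizer cannot leave the constraint j inactive.  For uniqueness, strong convexity makes the
  midpoint of two distinct perturbed minimizers strictly better by a multiple of their squared
  distance, which pays for the small step needed to make that midpoint feasible.
*)
theory Submission
  imports Defs
begin

subsection \<open>Gradients of functions of class C1 and C2\<close>

text \<open>A C2-small perturbation of a convex function need not be convex (affine constraints
  already show this), and the compact set to which the perturbed problem is restricted need not be
  convex either. So uniqueness of the perturbed minimizer cannot be read off from convexity of the
  perturbed problem. Convexity is used for the unperturbed functions, in midpoint form; the Hessian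
  bound says that a perturbation spoils a midpoint inequality by at most
  \<open>e * (dist y z)\<^sup>2\<close>. This needs the segment from \<open>y\<close> to
  \<open>z\<close> to stay where the perturbation is controlled, and localization in a small ball
  about the minimizer provides that. The threshold must be uniform in all \<open>s\<close> and
  \<open>r\<close>. The stability results therefore have the form
  \<open>\<forall>\<^sub>F e in at_right 0. \<forall>s r. ...\<close>: finitely many of them can be
  intersected without naming thresholds, and \<open>s\<close> and \<open>r\<close> enter the
  estimates only through \<open>e\<close>.\<close>

lemma GDERIV_frechet_derivative:
  fixes f :: "'a::euclidean_space \<Rightarrow> real"
  assumes "f differentiable at y"
  shows "GDERIV f y :> (\<Sum>b\<in>Basis. frechet_derivative f (at y) b *\<^sub>R b)"
proof -
  interpret L: linear "frechet_derivative f (at y)"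
    by (rule linear_frechet_derivative[OF assms])
  have "frechet_derivative f (at y) = (\<lambda>v. v \<bullet> (\<Sum>b\<in>Basis. frechet_derivative f (at y) b *\<^sub>R b))"
  proof
    fix v :: 'a
    have "frechet_derivative f (at y) v = frechet_derivative f (at y) (\<Sum>b\<in>Basis. (v \<bullet> b) *\<^sub>R b)"
      by (simp add: euclidean_representation)
    also have "\<dots> = (\<Sum>b\<in>Basis. (v \<bullet> b) * frechet_derivative f (at y) b)"
      by (simp add: L.sum L.scale)
    finally show "frechet_derivative f (at y) v = v \<bullet> (\<Sum>b\<in>Basis. frechet_derivative f (at y) b *\<^sub>R b)"
      by (simp add: inner_sum_right mult.commute)
  qed
  then show ?thesis
    unfolding gderiv_def using assms frechet_derivative_works by metis
qed

lemma gradient_frechet_derivative: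
  fixes f :: "'a::euclidean_space \<Rightarrow> real"
  assumes "f differentiable at y"
  shows "gradient f y = (\<Sum>b\<in>Basis. frechet_derivative f (at y) b *\<^sub>R b)"
  by (intro gradient_eqI GDERIV_frechet_derivative assms)

lemma GDERIV_gradient:
  fixes f :: "'a::euclidean_space \<Rightarrow> real"
  assumes "f differentiable at y"
  shows "GDERIV f y :> gradient f y"
  using GDERIV_frechet_derivative[OF assms] gradient_frechet_derivative[OF assms] by simp

lemma GDERIV_isCont: "GDERIV f y :> D \<Longrightarrow> isCont f y"
  unfolding gderiv_def by (rule has_derivative_continuous)

lemma GDERIV_line:
  assumes "GDERIV f (y + t *\<^sub>R d) :> D"
  shows "((\<lambda>t. f (y + t *\<^sub>R d)) has_real_derivative d \<bullet> D) (at t)"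
proof -
  have *: "((\<lambda>t. y + t *\<^sub>R d) has_derivative (\<lambda>h. h *\<^sub>R d)) (at t)"
    by (auto intro!: derivative_eq_intros)
  have "((\<lambda>t. f (y + t *\<^sub>R d)) has_derivative (\<lambda>h. (h *\<^sub>R d) \<bullet> D)) (at t)"
    using has_derivative_compose[OF *, of f "\<lambda>h. h \<bullet> D"] assms unfolding gderiv_def by simp
  then show ?thesis
    by (simp add: has_field_derivative_def mult.commute[of "d \<bullet> D"] mult_commute_abs)
qed

lemma mvt_GDERIV:
  fixes f :: "'a::real_inner \<Rightarrow> real"
  assumes "\<And>t. 0 \<le> t \<Longrightarrow> t \<le> 1 \<Longrightarrow> GDERIV f (y + t *\<^sub>R d) :> D (y + t *\<^sub>R d)"
  shows "\<exists>t\<in>{0..1}. f (y + d) - f y = d \<bullet> D (y + t *\<^sub>R d)"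
proof -
  have "((\<lambda>t. f (y + t *\<^sub>R d)) has_derivative (\<lambda>h. h * (d \<bullet> D (y + t *\<^sub>R d)))) (at t within {0..1})"
    if "0 \<le> t" "t \<le> 1" for t
    using has_derivative_at_withinI[OF GDERIV_line[OF assms[OF that], unfolded has_field_derivative_def]]
    by (simp add: mult_commute_abs)
  from mvt_very_simple[OF zero_le_one this] show ?thesis
    by force
qed

lemma Ck_on_1_gradient_continuous:
  fixes f :: "'a::euclidean_space \<Rightarrow> real"
  assumes "Ck_on 1 f U"
  shows "continuous_on U (gradient f)"
proof -
  have "continuous_on U (\<lambda>z. \<Sum>b\<in>Basis. frechet_derivative f (at z) b *\<^sub>R b)"
    using assms by (intro continuous_intros) auto
  then show ?thesis
    using assms by (auto simp: gradient_frechet_derivative cong: continuous_on_cong)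
qed

text \<open>The recursion demands continuity only at its last level; one level up it follows from
  differentiability.\<close>

lemma Ck_on_2_imp_Ck_on_1:
  assumes "Ck_on 2 f U"
  shows "Ck_on 1 f U"
proof -
  have "\<forall>z\<in>U. f differentiable at z"
    and "\<forall>v. \<forall>z\<in>U. (\<lambda>z. frechet_derivative f (at z) v) differentiable at z"
    using assms by (auto simp: numeral_2_eq_2)
  then show ?thesis
    by (auto intro!: continuous_at_imp_continuous_on differentiable_imp_continuous_within)
qed

lemma Ck_on_2_gradient_has_derivative:
  fixes f :: "'a::euclidean_space \<Rightarrow> real"
  assumes "Ck_on 2 f U" "open U" "z \<in> U"
  shows "(gradient f has_derivative
    (\<lambda>v. \<Sum>b\<in>Basis. frechet_derivative (\<lambda>z. frechet_derivative f (at z) b) (at z) v *\<^sub>R b)) (at z)"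
proof -
  have f: "f differentiable at z"
    and f': "(\<lambda>z. frechet_derivative f (at z) b) differentiable at z" if "z \<in> U" for z b
    using assms that by (auto simp: numeral_2_eq_2)
  have "((\<lambda>z. \<Sum>b\<in>Basis. frechet_derivative f (at z) b *\<^sub>R b) has_derivative
    (\<lambda>v. \<Sum>b\<in>Basis. frechet_derivative (\<lambda>z. frechet_derivative f (at z) b) (at z) v *\<^sub>R b)) (at z)"
    by (intro has_derivative_sum has_derivative_scaleR_left)
       (use f'[OF assms(3)] frechet_derivative_works in blast)
  then show ?thesis
    by (rule has_derivative_transform_within_open[OF _ assms(2,3)])
       (simp add: gradient_frechet_derivative f)
qed

lemma Ck_on_2_hessian_continuous:
  fixes f :: "'a::euclidean_space \<Rightarrow> real"
  assumes "Ck_on 2 f U" "open U"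
  shows "continuous_on U (\<lambda>z. hessian f z v)"
proof -
  have "continuous_on U
    (\<lambda>z. \<Sum>b\<in>Basis. frechet_derivative (\<lambda>z. frechet_derivative f (at z) b) (at z) v *\<^sub>R b)"
    using assms by (intro continuous_intros) (auto simp: numeral_2_eq_2)
  moreover have "hessian f z =
    (\<lambda>v. \<Sum>b\<in>Basis. frechet_derivative (\<lambda>z. frechet_derivative f (at z) b) (at z) v *\<^sub>R b)"
    if "z \<in> U" for z
    unfolding hessian_def
    by (rule frechet_derivative_at[OF Ck_on_2_gradient_has_derivative[OF assms that], symmetric])
  ultimately show ?thesis
    by (simp cong: continuous_on_cong)
qed

lemma
  fixes f :: "'a::euclidean_space \<Rightarrow> real"
  assumes "C2_near K f"
  shows C2_near_GDERIV: "y \<in> K \<Longrightarrow> GDERIV f y :> gradient f y"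
    and C2_near_hessian: "y \<in> K \<Longrightarrow> (gradient f has_derivative hessian f y) (at y)"
    and C2_near_continuous_gradient: "continuous_on K (gradient f)"
    and C2_near_continuous_hessian: "continuous_on K (\<lambda>y. hessian f y v)"
proof -
  obtain U where U: "open U" "K \<subseteq> U" "Ck_on 2 f U"
    using assms unfolding C2_near_def by blast
  show "GDERIV f y :> gradient f y" if "y \<in> K"
    using U that by (intro GDERIV_gradient) (auto simp: numeral_2_eq_2)
  show "(gradient f has_derivative hessian f y) (at y)" if "y \<in> K"
    unfolding hessian_def using Ck_on_2_gradient_has_derivative[OF U(3,1) subsetD[OF U(2) that]]
    by (simp add: differentiableI flip: frechet_derivative_works)
  show "continuous_on K (gradient f)"
    using Ck_on_1_gradient_continuous[OF Ck_on_2_imp_Ck_on_1[OF U(3)]] U(2)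
    by (rule continuous_on_subset)
  show "continuous_on K (\<lambda>y. hessian f y v)"
    using Ck_on_2_hessian_continuous[OF U(3,1)] U(2) by (rule continuous_on_subset)
qed

section \<open>What a small C2 norm says about a perturbation\<close>

lemma compact_continuous_on_bdd_above:
  fixes f :: "'a::topological_space \<Rightarrow> real"
  assumes "compact K" "continuous_on K f"
  shows "bdd_above (f ` K)"
  using assms by (intro bounded_imp_bdd_above compact_imp_bounded compact_continuous_image)

lemma
  fixes f :: "'a::euclidean_space \<Rightarrow> real"
  assumes "C2_near K f" "compact K" "y \<in> K"
  shows abs_le_C2_norm: "\<bar>f y\<bar> \<le> C2_norm K f"
    and norm_gradient_le_C2_norm: "norm (gradient f y) \<le> C2_norm K f"
    and onorm_hessian_le_C2_norm: "onorm (hessian f y) \<le> C2_norm K f"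
proof -
  have "continuous_on K f"
    by (meson C2_near_GDERIV[OF assms(1)] GDERIV_isCont continuous_at_imp_continuous_on)
  then have "bdd_above ((\<lambda>y. \<bar>f y\<bar>) ` K)"
    by (intro compact_continuous_on_bdd_above assms continuous_intros)
  from cSUP_upper[OF assms(3) this] show "\<bar>f y\<bar> \<le> C2_norm K f"
    unfolding C2_norm_def by (simp add: le_max_iff_disj)
  have "bdd_above ((\<lambda>y. norm (gradient f y)) ` K)"
    by (intro compact_continuous_on_bdd_above assms continuous_intros
        C2_near_continuous_gradient)
  from cSUP_upper[OF assms(3) this] show "norm (gradient f y) \<le> C2_norm K f"
    unfolding C2_norm_def by (simp add: le_max_iff_disj)
  \<comment> \<open>Continuity of the operator norm of the Hessian is bypassed: it is dominated by
    the sum of the norms of the images of the basis vectors, and each of these is continuous in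
    \<open>y\<close>.\<close>
  have "bdd_above ((\<lambda>y. \<Sum>b\<in>Basis. norm (hessian f y b)) ` K)"
    by (intro compact_continuous_on_bdd_above assms continuous_intros
        C2_near_continuous_hessian)
  then obtain M where M: "(\<Sum>b\<in>Basis. norm (hessian f z b)) \<le> M" if "z \<in> K" for z
    unfolding bdd_above_def by blast
  have "onorm (hessian f z) \<le> M" if "z \<in> K" for z
  proof -
    have "bounded_linear (hessian f z)"
      using C2_near_hessian[OF assms(1) that] by (rule has_derivative_bounded_linear)
    from onorm_componentwise[OF this] M[OF that] show ?thesis by simp
  qed
  then have "bdd_above ((\<lambda>y. onorm (hessian f y)) ` K)"
    by (meson bdd_above.I2)
  from cSUP_upper[OF assms(3) this] show "onorm (hessian f y) \<le> C2_norm K f"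
    unfolding C2_norm_def by (simp add: le_max_iff_disj)
qed

text \<open>Collects what the stability argument uses of a C2 bound. The midpoint clause is the
  integrated form of the Hessian bound; it is stated over convex subsets \<open>S\<close> because
  \<open>K\<close> may fail to be convex, and in this form the whole notion passes to subsets of
  \<open>K\<close>.\<close>

definition small_perturbation :: "'a::real_inner set \<Rightarrow> real \<Rightarrow> ('a \<Rightarrow> real) \<Rightarrow> bool" where
  "small_perturbation K e p \<longleftrightarrow>
     (\<forall>y\<in>K. \<bar>p y\<bar> \<le> e \<and> GDERIV p y :> gradient p y \<and> norm (gradient p y) \<le> e) \<and>
     (\<forall>S y z. convex S \<and> S \<subseteq> K \<and> y \<in> S \<and> z \<in> S \<longrightarrow>
        p (midpoint y z) \<le> (p y + p z) / 2 + e * (dist y z)\<^sup>2)"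

lemma small_perturbation_C2:
  fixes p :: "'a::euclidean_space \<Rightarrow> real"
  assumes "C2_near K p" "compact K" "C2_norm K p \<le> e"
  shows "small_perturbation K e p"
  unfolding small_perturbation_def
proof (intro conjI ballI allI impI)
  fix y assume y: "y \<in> K"
  show "\<bar>p y\<bar> \<le> e" "GDERIV p y :> gradient p y" "norm (gradient p y) \<le> e"
    using abs_le_C2_norm[OF assms(1,2) y] norm_gradient_le_C2_norm[OF assms(1,2) y] assms(3)
      C2_near_GDERIV[OF assms(1) y] by auto
next
  fix S :: "'a set" and y z
  assume "convex S \<and> S \<subseteq> K \<and> y \<in> S \<and> z \<in> S"
  then have S: "convex S" "S \<subseteq> K" and yz: "y \<in> S" "z \<in> S" by auto
  define m where "m = midpoint y z"
  define d where "d = (1/2) *\<^sub>R (y - z)"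
  have "y = (1/2) *\<^sub>R y + (1/2) *\<^sub>R y" "z = (1/2) *\<^sub>R z + (1/2) *\<^sub>R z"
    by (simp_all flip: scaleR_add_left)
  then have y_eq: "y = m + d" and z_eq: "z = m + - d"
    by (simp_all add: m_def d_def midpoint_def scaleR_add_right scaleR_diff_right)
  have mS: "m \<in> S"
    using midpoint_in_closed_segment convex_contains_segment S(1) yz unfolding m_def by blast
  have e: "0 \<le> e"
    using abs_le_C2_norm[OF assms(1,2), of y] S yz assms(3) by force
  \<comment> \<open>First-order expansion at the midpoint with a quadratic remainder, from the mean
    value theorem and the Lipschitz constant \<open>e\<close> of the gradient. Taken for
    \<open>w = d\<close> and \<open>w = - d\<close>, the linear terms cancel in the sum.\<close>
  have half: "p m + w \<bullet> gradient p m - e * (norm w)\<^sup>2 \<le> p (m + w)" if w: "m + w \<in> S" for w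
  proof -
    have seg: "m + t *\<^sub>R w \<in> S" if "0 \<le> t" "t \<le> 1" for t
      using convexD_alt[OF S(1) mS w that] by (simp add: algebra_simps)
    obtain t where t: "t \<in> {0..1}" "p (m + w) - p m = w \<bullet> gradient p (m + t *\<^sub>R w)"
      using mvt_GDERIV[of p m w "gradient p"] C2_near_GDERIV[OF assms(1)] seg S(2) by blast
    have "norm (gradient p (m + t *\<^sub>R w) - gradient p m) \<le> e * norm (m + t *\<^sub>R w - m)"
    proof (rule differentiable_bound[OF S(1)])
      show "(gradient p has_derivative hessian p u) (at u within S)" if "u \<in> S" for u
        using C2_near_hessian[OF assms(1)] S(2) that has_derivative_at_withinI by blast
      show "onorm (hessian p u) \<le> e" if "u \<in> S" for u
        using onorm_hessian_le_C2_norm[OF assms(1,2)] S(2) that assms(3) by force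
    qed (use seg t mS in auto)
    also have "\<dots> \<le> e * norm w"
      using t e by (intro mult_left_mono) (auto intro: mult_left_le_one_le)
    finally have "norm w * norm (gradient p (m + t *\<^sub>R w) - gradient p m) \<le> norm w * (e * norm w)"
      by (intro mult_left_mono) auto
    moreover have "\<bar>w \<bullet> (gradient p (m + t *\<^sub>R w) - gradient p m)\<bar>
        \<le> norm w * norm (gradient p (m + t *\<^sub>R w) - gradient p m)"
      by (rule Cauchy_Schwarz_ineq2)
    ultimately show ?thesis
      using t(2) by (simp add: inner_diff_right power2_eq_square algebra_simps)
  qed
  have "2 * p m \<le> p y + p z + 2 * (e * (norm d)\<^sup>2)"
    using half[of d, folded y_eq] half[of "- d", folded z_eq] yz by simp
  moreover have "e * (norm d)\<^sup>2 \<le> e * (dist y z)\<^sup>2"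
    using e by (intro mult_left_mono power_mono) (auto simp: d_def dist_norm)
  ultimately show "p (midpoint y z) \<le> (p y + p z) / 2 + e * (dist y z)\<^sup>2"
    unfolding m_def[symmetric] by argo
qed

lemma small_perturbation_subset:
  assumes "small_perturbation K e p" "L \<subseteq> K"
  shows "small_perturbation L e p"
  using assms unfolding small_perturbation_def by (meson order_trans subsetD)

text \<open>\<open>X\<close> is arbitrary, so a local extension \<open>F\<close> agrees with
  \<open>f\<close> only over \<open>X\<close>. The whole slice over \<open>x\<close> lies in
  \<open>X \<times> UNIV\<close>, however, so derivatives in \<open>y\<close> alone can be computed
  from \<open>F\<close>.\<close>

lemma smooth_on_slice:
  fixes f :: "'a::euclidean_space \<Rightarrow> 'b::euclidean_space \<Rightarrow> real"
  assumes "smooth_on (X \<times> UNIV) (\<lambda>(x, y). f x y)" "x \<in> X"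
  shows "GDERIV (f x) y :> gradient (f x) y" and "isCont (gradient (f x)) y"
proof -
  have "(x, y) \<in> X \<times> UNIV"
    using assms(2) by simp
  then obtain U F where U: "open U" "(x, y) \<in> U" and "\<forall>k. Ck_on k F U"
    and eq: "\<forall>w\<in>(X \<times> UNIV) \<inter> U. F w = (case w of (x, y) \<Rightarrow> f x y)"
    using assms(1) unfolding smooth_on_def by meson
  then have F: "Ck_on 1 F U" by blast
  define V where "V = Pair x -` U"
  have V: "open V" "y \<in> V"
    using U by (auto simp: V_def intro!: open_vimage continuous_intros)
  have der: "(f x has_derivative (\<lambda>v. frechet_derivative F (at (x, z)) (0, v))) (at z)"
    if "z \<in> V" for z
  proof -
    have "F differentiable at (x, z)"
      using F that by (simp add: V_def)
    then have "(F has_derivative frechet_derivative F (at (x, z))) (at (x, z))"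
      by (rule frechet_derivative_works[THEN iffD1])
    then have "((\<lambda>z. F (x, z)) has_derivative (\<lambda>v. frechet_derivative F (at (x, z)) (0, v))) (at z)"
      by (rule has_derivative_compose[rotated]) (auto intro!: derivative_eq_intros)
    then show ?thesis
      by (rule has_derivative_transform_within_open[OF _ V(1) that])
         (use eq assms(2) in \<open>auto simp: V_def\<close>)
  qed
  have "continuous_on V (\<lambda>z. frechet_derivative (f x) (at z) v)" for v
  proof -
    have "continuous_on U (\<lambda>w. frechet_derivative F (at w) (0, v))"
      using F by simp
    moreover have "continuous_on V (Pair x)" "Pair x ` V \<subseteq> U"
      by (auto simp: V_def intro!: continuous_intros)
    ultimately have "continuous_on V (\<lambda>z. frechet_derivative F (at (x, z)) (0, v))"
      by (rule continuous_on_compose2)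
    moreover have "frechet_derivative (f x) (at z) v = frechet_derivative F (at (x, z)) (0, v)"
      if "z \<in> V" for z
      by (simp flip: frechet_derivative_at[OF der[OF that]])
    ultimately show ?thesis
      by (simp cong: continuous_on_cong)
  qed
  then have "Ck_on 1 (f x) V"
    using differentiableI[OF der] by simp
  from Ck_on_1_gradient_continuous[OF this] V show "isCont (gradient (f x)) y"
    using continuous_on_eq_continuous_at by blast
  show "GDERIV (f x) y :> gradient (f x) y"
    using der[OF V(2)] by (intro GDERIV_gradient differentiableI)
qed

subsection \<open>First-order conditions\<close>

lemma eventually_descent:
  fixes f :: "'a::real_inner \<Rightarrow> real"
  assumes "GDERIV f y :> D" "d \<bullet> D < 0"
  shows "\<forall>\<^sub>F t in at_right 0. f (y + t *\<^sub>R d) < f y"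
proof -
  have "((\<lambda>t. f (y + t *\<^sub>R d)) has_real_derivative d \<bullet> D) (at 0)"
    using assms(1) by (intro GDERIV_line) simp
  from DERIV_neg_dec_right[OF this assms(2)] show ?thesis
    by (auto simp: eventually_at_right_field)
qed

text \<open>Active constraints drop to first order, inactive ones stay negative by continuity;
  finiteness of the index type gives a common step length.\<close>

lemma eventually_feasible_direction:
  fixes h :: "'k::finite \<Rightarrow> 'a::real_inner \<Rightarrow> real"
  assumes "\<And>i. GDERIV (h i) y :> E i" "\<And>i. h i y \<le> 0" "\<And>i. h i y = 0 \<Longrightarrow> d \<bullet> E i < 0"
  shows "\<forall>\<^sub>F t in at_right 0. \<forall>i. h i (y + t *\<^sub>R d) < 0"
proof (rule eventually_all_finite)
  fix i
  show "\<forall>\<^sub>F t in at_right 0. h i (y + t *\<^sub>R d) < 0"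
  proof (cases "h i y = 0")
    case True
    then show ?thesis
      using eventually_descent[OF assms(1)[of i] assms(3)] by simp
  next
    case False
    have "((\<lambda>t. h i (y + t *\<^sub>R d)) \<longlongrightarrow> h i y) (at_right 0)"
      by (intro isCont_tendsto_compose[OF GDERIV_isCont[OF assms(1)]] tendsto_eq_intros) auto
    then show ?thesis
      using False assms(2)[of i] by (intro order_tendstoD(2)) auto
  qed
qed

text \<open>A linear functional with the prescribed values extends from the independent vectors, and
  its adjoint at \<open>1\<close> represents it. The inward, dual and release directions below all
  arise this way: the first-order change of each active constraint can be chosen freely.\<close>

lemma independent_family_prescribed_inner:
  fixes a :: "'k \<Rightarrow> 'a::euclidean_space"
  assumes "inj_on a J" "independent (a ` J)"
  shows "\<exists>d. \<forall>i\<in>J. d \<bullet> a i = b i"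
proof -
  obtain f :: "'a \<Rightarrow> real" where f: "linear f" "\<forall>v\<in>a ` J. f v = b (inv_into J a v)"
    using linear_independent_extend[OF assms(2), of "\<lambda>v. b (inv_into J a v)"] by auto
  have "adjoint f 1 \<bullet> a i = b i" if "i \<in> J" for i
    using f(2) assms(1) that adjoint_works[OF f(1), of "a i" 1] by (simp add: inner_commute)
  then show ?thesis by blast
qed

lemma span_image_sum:
  assumes "inj_on a J" "finite J" "c \<in> span (a ` J)"
  shows "\<exists>u. c = (\<Sum>i\<in>J. u i *\<^sub>R a i)"
proof -
  obtain w where "c = (\<Sum>v\<in>a ` J. w v *\<^sub>R v)"
    using assms(2,3) by (auto simp: span_finite)
  then have "c = (\<Sum>i\<in>J. w (a i) *\<^sub>R a i)"
    using assms(1) by (simp add: sum.reindex)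
  then show ?thesis by (rule exI[of _ "\<lambda>i. w (a i)"])
qed

text \<open>Independence of the active gradients stands in for a theorem of the alternative:
  \<open>D\<close> is shown to lie in their span, and the signs of its coordinates are tested one at
  a time.\<close>

lemma KKT_multipliers:
  fixes f :: "'a::euclidean_space \<Rightarrow> real" and h :: "'k::finite \<Rightarrow> 'a \<Rightarrow> real"
  assumes f: "GDERIV f y :> D" and h: "\<And>i. GDERIV (h i) y :> E i"
    and feas: "\<And>i. h i y \<le> 0" and min: "\<And>z. (\<And>i. h i z \<le> 0) \<Longrightarrow> f y \<le> f z"
    and inj: "inj_on E {i. h i y = 0}" and indep: "independent (E ` {i. h i y = 0})"
  obtains l where "\<And>i. 0 \<le> l i" "\<And>i. h i y \<noteq> 0 \<Longrightarrow> l i = 0" "D + (\<Sum>i\<in>UNIV. l i *\<^sub>R E i) = 0"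
proof -
  define J where "J = {i. h i y = 0}"
  obtain d0 where d0: "\<And>i. i \<in> J \<Longrightarrow> d0 \<bullet> E i = -1"
    using independent_family_prescribed_inner[OF inj indep, of "\<lambda>_. -1"] unfolding J_def by auto
  \<comment> \<open>Along \<open>d\<close> an active constraint may have rate zero, which does not
    ensure feasibility. Tilting \<open>d\<close> slightly towards \<open>d0\<close> makes all these
    rates strictly negative and keeps the objective decreasing.\<close>
  have dual: "0 \<le> d \<bullet> D" if d: "\<And>i. i \<in> J \<Longrightarrow> d \<bullet> E i \<le> 0" for d
  proof (rule ccontr)
    assume "\<not> 0 \<le> d \<bullet> D"
    moreover have "((\<lambda>t. (d + t *\<^sub>R d0) \<bullet> D) \<longlongrightarrow> d \<bullet> D) (at_right 0)"
      by (auto intro!: tendsto_eq_intros)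
    ultimately have "\<forall>\<^sub>F t in at_right 0. (d + t *\<^sub>R d0) \<bullet> D < 0"
      by (intro order_tendstoD(2)) auto
    then have "\<forall>\<^sub>F t in at_right (0::real). (d + t *\<^sub>R d0) \<bullet> D < 0 \<and> 0 < t"
      by (intro eventually_conj eventually_at_right_less)
    then obtain t :: real where t: "(d + t *\<^sub>R d0) \<bullet> D < 0" "0 < t"
      using eventually_happens'[of "at_right (0::real)"] by fastforce
    have "(d + t *\<^sub>R d0) \<bullet> E i < 0" if "h i y = 0" for i
      using d[of i] d0[of i] t(2) that by (simp add: J_def inner_add_left)
    from eventually_feasible_direction[OF h feas this] eventually_descent[OF f t(1)]
    have "\<forall>\<^sub>F u in at_right (0::real). (\<forall>i. h i (y + u *\<^sub>R (d + t *\<^sub>R d0)) < 0)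
        \<and> f (y + u *\<^sub>R (d + t *\<^sub>R d0)) < f y"
      by (rule eventually_conj)
    then obtain u where "\<forall>i. h i (y + u *\<^sub>R (d + t *\<^sub>R d0)) < 0"
        "f (y + u *\<^sub>R (d + t *\<^sub>R d0)) < f y"
      using eventually_happens'[of "at_right (0::real)"] by fastforce
    with min[of "y + u *\<^sub>R (d + t *\<^sub>R d0)"] show False
      by (simp add: less_imp_le linorder_not_le[symmetric])
  qed
  \<comment> \<open>\<open>z\<close> is the part of \<open>D\<close> orthogonal to all active
    gradients. The direction \<open>- z\<close> moves no active constraint to first order, so
    \<open>dual\<close> gives \<open>z \<bullet> z \<le> 0\<close>.\<close>
  obtain c z where c: "c \<in> span (E ` J)" and z: "\<And>w. w \<in> span (E ` J) \<Longrightarrow> orthogonal z w"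
    and D: "D = c + z"
    using orthogonal_subspace_decomp_exists by blast
  have zE: "z \<bullet> E i = 0" if "i \<in> J" for i
    using z[of "E i"] that by (auto simp: orthogonal_def span_base)
  have "z \<bullet> D = z \<bullet> z"
    using z[OF c] by (simp add: D orthogonal_def inner_add_right)
  moreover have "0 \<le> (- z) \<bullet> D"
    using zE by (intro dual) simp
  ultimately have "z = 0"
    by (metis inner_ge_zero inner_gt_zero_iff inner_minus_left neg_0_le_iff_le order_antisym less_irrefl)
  then obtain u where u: "D = (\<Sum>i\<in>J. u i *\<^sub>R E i)"
    using span_image_sum[OF inj _ c[unfolded J_def]] D unfolding J_def by auto
  have u_le: "u j \<le> 0" if "j \<in> J" for j
  proof -
    \<comment> \<open>Dual-basis direction: it decreases constraint \<open>j\<close> alone, so that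
      \<open>d \<bullet> D = - u j\<close>.\<close>
    obtain d where d: "\<And>i. i \<in> J \<Longrightarrow> d \<bullet> E i = (if i = j then -1 else 0)"
      using independent_family_prescribed_inner[OF inj indep, of "\<lambda>i. if i = j then -1 else 0"]
      unfolding J_def by auto
    have "d \<bullet> D = (\<Sum>i\<in>J. if i = j then - u j else 0)"
      unfolding u inner_sum_right by (intro sum.cong) (auto simp: d)
    also have "\<dots> = - u j"
      using that by simp
    finally show ?thesis
      using dual[of d] d by auto
  qed
  show ?thesis
  proof (rule that[of "\<lambda>i. if i \<in> J then - u i else 0"])
    have "(\<Sum>i\<in>UNIV. (if i \<in> J then - u i else 0) *\<^sub>R E i) = (\<Sum>i\<in>J. - u i *\<^sub>R E i)"
      by (rule sum.mono_neutral_cong_right) auto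
    then show "D + (\<Sum>i\<in>UNIV. (if i \<in> J then - u i else 0) *\<^sub>R E i) = 0"
      by (simp add: u sum_negf)
  qed (use u_le J_def in auto)
qed

text \<open>A positive multiplier \<open>l j\<close> is the rate at which the objective gains when
  \<open>h j\<close> is allowed to rise. Pushing the other active constraints down at a small enough
  rate does not use up this gain.\<close>

lemma release_direction:
  fixes E :: "'k::finite \<Rightarrow> 'a::euclidean_space"
  assumes "inj_on E J" "independent (E ` J)" and stat: "D + (\<Sum>i\<in>UNIV. l i *\<^sub>R E i) = 0"
    and l: "\<And>i. 0 \<le> l i" "\<And>i. i \<notin> J \<Longrightarrow> l i = 0" and j: "j \<in> J" "0 < l j"
  shows "\<exists>d. d \<bullet> D < 0 \<and> (\<forall>i\<in>J. i \<noteq> j \<longrightarrow> d \<bullet> E i < 0)"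
proof -
  define S where "S = (\<Sum>i\<in>J - {j}. l i)"
  \<comment> \<open>With rate \<open>1\<close> on \<open>j\<close> and \<open>- \<tau>\<close> on
    the other active indices, stationarity gives
    \<open>d \<bullet> D = - (l j - \<tau> * S)\<close>. This choice makes
    \<open>\<tau> * S < l j\<close>, and the added \<open>1\<close> keeps the denominator positive
    when \<open>S = 0\<close>.\<close>
  define \<tau> where "\<tau> = l j / (1 + S)"
  have S: "0 \<le> S"
    unfolding S_def by (intro sum_nonneg l)
  then have \<tau>: "0 < \<tau>" "\<tau> * S < l j"
    using j(2) by (auto simp: \<tau>_def field_simps add_pos_nonneg)
  obtain d where d: "\<And>i. i \<in> J \<Longrightarrow> d \<bullet> E i = (if i = j then 1 else - \<tau>)"
    using independent_family_prescribed_inner[OF assms(1,2), of "\<lambda>i. if i = j then 1 else - \<tau>"]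
    by auto
  have "(\<Sum>i\<in>UNIV. l i * (d \<bullet> E i)) = (\<Sum>i\<in>J. l i * (d \<bullet> E i))"
    using l(2) by (intro sum.mono_neutral_right) auto
  also have "\<dots> = l j * (d \<bullet> E j) + (\<Sum>i\<in>J - {j}. l i * (d \<bullet> E i))"
    using j(1) by (intro sum.remove) auto
  also have "(\<Sum>i\<in>J - {j}. l i * (d \<bullet> E i)) = (\<Sum>i\<in>J - {j}. - \<tau> * l i)"
    by (intro sum.cong) (auto simp: d)
  finally have "(\<Sum>i\<in>UNIV. l i * (d \<bullet> E i)) = l j - \<tau> * S"
    using j(1) by (simp add: d S_def sum_negf sum_distrib_left)
  moreover have "d \<bullet> D + (\<Sum>i\<in>UNIV. l i * (d \<bullet> E i)) = 0"
    using arg_cong[OF stat, of "(\<bullet>) d"] by (simp add: inner_add_right inner_sum_right)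
  ultimately have "d \<bullet> D < 0"
    using \<tau>(2) by linarith
  then show ?thesis
    using d \<tau>(1) by (intro exI[of _ d]) auto
qed

subsection \<open>Stability of a nondegenerate minimizer\<close>

text \<open>The problem at fixed \<open>x\<close>, with \<open>K\<close> in the role of the inner
  compact set. LICQ and SCSC survive as the two families of directions \<open>inward\<close> and
  \<open>release\<close>. Both are given by finitely many strict inequalities on gradients at
  \<open>y0\<close>, hence they persist under small changes of the point and of the
  gradients.\<close>

locale nondegenerate_problem =
  fixes g :: "'a::euclidean_space \<Rightarrow> real" and h :: "'k::finite \<Rightarrow> 'a \<Rightarrow> real"
    and y0 :: 'a and \<mu> :: real and K :: "'a set"
  assumes g_deriv: "GDERIV g y :> gradient g y" and g_cont: "isCont (gradient g) y"
    and h_deriv: "GDERIV (h i) y :> gradient (h i) y" and h_cont: "isCont (gradient (h i)) y"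
    and \<mu>: "0 < \<mu>"
    and g_midpoint: "g (midpoint y z) \<le> (g y + g z) / 2 - \<mu> * (dist y z)\<^sup>2"
    and h_midpoint: "h i (midpoint y z) \<le> (h i y + h i z) / 2"
    and feas: "h i y0 \<le> 0"
    and min: "(\<And>i. h i z \<le> 0) \<Longrightarrow> z \<noteq> y0 \<Longrightarrow> g y0 < g z"
    and inward: "\<exists>d. \<forall>i. h i y0 = 0 \<longrightarrow> d \<bullet> gradient (h i) y0 < 0"
    and release: "h j y0 = 0 \<Longrightarrow> \<exists>d. d \<bullet> gradient g y0 < 0 \<and>
        (\<forall>i. i \<noteq> j \<longrightarrow> h i y0 = 0 \<longrightarrow> d \<bullet> gradient (h i) y0 < 0)"
    and K: "compact K" "y0 \<in> interior K"
begin

definition perturbation :: "real \<Rightarrow> ('a \<Rightarrow> real) \<Rightarrow> ('k \<Rightarrow> 'a \<Rightarrow> real) \<Rightarrow> bool" where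
  "perturbation e s r \<longleftrightarrow> small_perturbation K e s \<and> (\<forall>i. small_perturbation K e (r i))"

definition perturbed_feasible :: "('k \<Rightarrow> 'a \<Rightarrow> real) \<Rightarrow> 'a set" where
  "perturbed_feasible r = {y \<in> K. \<forall>i. h i y + r i y \<le> 0}"

definition perturbed_min :: "('a \<Rightarrow> real) \<Rightarrow> ('k \<Rightarrow> 'a \<Rightarrow> real) \<Rightarrow> 'a \<Rightarrow> bool" where
  "perturbed_min s r y \<longleftrightarrow>
     y \<in> perturbed_feasible r \<and> (\<forall>z\<in>perturbed_feasible r. g y + s y \<le> g z + s z)"

text \<open>By Cauchy-Schwarz a perturbation costs at most \<open>e * norm d\<close> in a
  directional derivative. Later estimates carry this term in place of \<open>s\<close> and
  \<open>r\<close>, so they become conditions on the pair of a point and \<open>e\<close>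
  alone.\<close>

lemma
  assumes "perturbation e s r" "y \<in> K"
  shows s_abs: "\<bar>s y\<bar> \<le> e" and r_abs: "\<bar>r i y\<bar> \<le> e"
    and gs_deriv: "GDERIV (\<lambda>y. g y + s y) y :> gradient g y + gradient s y"
    and hr_deriv: "GDERIV (\<lambda>y. h i y + r i y) y :> gradient (h i) y + gradient (r i) y"
    and gs_gradient: "d \<bullet> (gradient g y + gradient s y) \<le> d \<bullet> gradient g y + e * norm d"
    and hr_gradient: "d \<bullet> (gradient (h i) y + gradient (r i) y) \<le> d \<bullet> gradient (h i) y + e * norm d"
proof -
  have le: "d \<bullet> v \<le> e * norm d" if "norm v \<le> e" for v
    using norm_cauchy_schwarz[of d v] mult_left_mono[OF that norm_ge_zero[of d]]
    by (simp add: mult.commute)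
  show "\<bar>s y\<bar> \<le> e" "\<bar>r i y\<bar> \<le> e"
    "GDERIV (\<lambda>y. g y + s y) y :> gradient g y + gradient s y"
    "GDERIV (\<lambda>y. h i y + r i y) y :> gradient (h i) y + gradient (r i) y"
    "d \<bullet> (gradient g y + gradient s y) \<le> d \<bullet> gradient g y + e * norm d"
    "d \<bullet> (gradient (h i) y + gradient (r i) y) \<le> d \<bullet> gradient (h i) y + e * norm d"
    using assms unfolding perturbation_def small_perturbation_def
    by (auto intro!: GDERIV_add g_deriv h_deriv le simp: inner_add_right)
qed

section \<open>Existence and localization of perturbed minimizers\<close>

lemma g_isCont: "isCont g y" and h_isCont: "isCont (h i) y"
  using g_deriv h_deriv GDERIV_isCont by blast+

text \<open>A short inward step from \<open>y0\<close>. Strict feasibility lets \<open>p\<close>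
  survive the perturbation; its nearly optimal value makes it a competitor that perturbed minimizers
  must beat.\<close>

lemma slater:
  assumes "0 < \<eta>"
  obtains p where "p \<in> K" "\<And>i. h i p < 0" "g p < g y0 + \<eta>"
proof -
  obtain d where d: "\<And>i. h i y0 = 0 \<Longrightarrow> d \<bullet> gradient (h i) y0 < 0"
    using inward by blast
  have lim: "((\<lambda>t. y0 + t *\<^sub>R d) \<longlongrightarrow> y0) (at_right 0)"
    by (auto intro!: tendsto_eq_intros)
  have "\<forall>\<^sub>F t in at_right 0. y0 + t *\<^sub>R d \<in> interior K"
    using lim K(2) by (rule topological_tendstoD[OF _ open_interior])
  moreover have "\<forall>\<^sub>F t in at_right 0. g (y0 + t *\<^sub>R d) < g y0 + \<eta>"
    using isCont_tendsto_compose[OF g_isCont lim] by (rule order_tendstoD(2)) (use assms in simp)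
  ultimately have "\<forall>\<^sub>F t in at_right 0. (\<forall>i. h i (y0 + t *\<^sub>R d) < 0) \<and>
      y0 + t *\<^sub>R d \<in> interior K \<and> g (y0 + t *\<^sub>R d) < g y0 + \<eta>"
    using eventually_feasible_direction[OF h_deriv feas d] by (intro eventually_conj)
  then obtain t where "\<forall>i. h i (y0 + t *\<^sub>R d) < 0" "y0 + t *\<^sub>R d \<in> interior K"
      "g (y0 + t *\<^sub>R d) < g y0 + \<eta>"
    using eventually_happens'[of "at_right (0::real)"] by fastforce
  then show ?thesis
    using interior_subset that by blast
qed

lemma eventually_less_at_right_0: "0 < c \<Longrightarrow> \<forall>\<^sub>F e in at_right 0. e * b < (c::real)"
  by (rule order_tendstoD(2)[of _ 0]) (auto intro!: tendsto_eq_intros)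

text \<open>Once \<open>e\<close> is below every slack of a Slater point, the perturbed feasible set
  is nonempty, and it is compact as a closed part of \<open>K\<close>.\<close>

lemma eventually_perturbed_min_exists:
  "\<forall>\<^sub>F e in at_right 0. \<forall>s r. perturbation e s r \<longrightarrow> (\<exists>y. perturbed_min s r y)"
proof -
  obtain p where p: "p \<in> K" "\<And>i. h i p < 0"
    using slater[OF zero_less_one] by blast
  have "\<forall>\<^sub>F e in at_right 0. \<forall>i. e * 1 < - h i p"
    using p(2) by (intro eventually_all_finite eventually_less_at_right_0) simp
  then show ?thesis
  proof eventually_elim
    case (elim e)
    show ?case
    proof (intro allI impI)
      fix s r assume pert: "perturbation e s r"
      have cont: "continuous_on K (\<lambda>y. g y + s y)" "continuous_on K (\<lambda>y. h i y + r i y)" for i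
        by (intro continuous_at_imp_continuous_on ballI GDERIV_isCont,
            erule gs_deriv[OF pert] hr_deriv[OF pert])+
      have "perturbed_feasible r = K \<inter> (\<Inter>i. {y \<in> K. h i y + r i y \<le> 0})"
        by (auto simp: perturbed_feasible_def)
      moreover have "closed (\<Inter>i. {y \<in> K. h i y + r i y \<le> 0})"
        by (intro closed_INT ballI continuous_on_closed_Collect_le cont continuous_on_const
            compact_imp_closed[OF K(1)])
      ultimately have "compact (perturbed_feasible r)"
        using K(1) by (simp add: compact_Int_closed)
      moreover have "h i p + r i p \<le> 0" for i
        using r_abs[OF pert p(1), of i] elim[rule_format, of i] by linarith
      then have "p \<in> perturbed_feasible r"
        using p(1) by (simp add: perturbed_feasible_def)
      moreover have "continuous_on (perturbed_feasible r) (\<lambda>y. g y + s y)"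
        using cont(1) by (rule continuous_on_subset) (auto simp: perturbed_feasible_def)
      ultimately obtain y where "y \<in> perturbed_feasible r"
          "\<forall>z\<in>perturbed_feasible r. g y + s y \<le> g z + s z"
        using continuous_attains_inf[of "perturbed_feasible r" "\<lambda>y. g y + s y"] by blast
      then show "\<exists>y. perturbed_min s r y"
        unfolding perturbed_min_def by blast
    qed
  qed
qed

text \<open>Perturbed feasible points may violate the original constraints slightly, so a gap over
  feasible points would not suffice. The function \<open>\<phi>\<close> adds objective excess and
  constraint violation; it is positive away from \<open>y0\<close>, hence bounded below on the
  compact set \<open>K - W\<close>.\<close>

lemma uniform_gap:
  assumes "open W" "y0 \<in> W"
  obtains \<eta> where "0 < \<eta>"
    "\<And>y. y \<in> K - W \<Longrightarrow> (\<And>i. h i y < \<eta>) \<Longrightarrow> g y0 + \<eta> \<le> g y"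
proof (cases "K - W = {}")
  case True
  then show ?thesis using that[of 1] by auto
next
  case False
  define \<phi> where "\<phi> y = max 0 (g y - g y0) + (\<Sum>i\<in>UNIV. max 0 (h i y))" for y
  have "continuous_on (K - W) \<phi>"
    unfolding \<phi>_def
    by (intro continuous_intros continuous_at_imp_continuous_on ballI g_isCont h_isCont)
  moreover have "compact (K - W)"
    using K(1) assms(1) by (rule compact_diff)
  ultimately obtain z where z: "z \<in> K - W" and z_le: "\<And>y. y \<in> K - W \<Longrightarrow> \<phi> z \<le> \<phi> y"
    using False continuous_attains_inf by metis
  have sum_nonneg: "0 \<le> (\<Sum>i\<in>UNIV. max 0 (h i y))" for y
    by (intro sum_nonneg) auto
  have "0 < \<phi> z"
  proof (cases "\<forall>i. h i z \<le> 0")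
    case True
    then have "g y0 < g z"
      using z assms(2) by (intro min) auto
    with sum_nonneg[of z] show ?thesis by (simp add: \<phi>_def)
  next
    case False
    then obtain i where "0 < h i z" by (auto simp: not_le)
    also have "h i z \<le> (\<Sum>i\<in>UNIV. max 0 (h i z))"
      using member_le_sum[of i UNIV "\<lambda>i. max 0 (h i z)"] by simp
    finally show ?thesis by (simp add: \<phi>_def)
  qed
  \<comment> \<open>\<open>\<phi>\<close> has one objective term and \<open>CARD('k)\<close>
    constraint terms. If every violation is below one share of the minimum, the objective term must
    cover the remaining share.\<close>
  define \<eta> where "\<eta> = \<phi> z / (real CARD('k) + 1)"
  have "\<eta> * (real CARD('k) + 1) = \<phi> z"
    unfolding \<eta>_def by (rule nonzero_eq_divide_eq[THEN iffD1]) (auto simp: add_nonneg_eq_0_iff)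
  moreover have "0 < \<eta>"
    using \<open>0 < \<phi> z\<close> by (simp add: \<eta>_def add_nonneg_pos)
  ultimately have \<eta>: "0 < \<eta>" "\<phi> z = \<eta> + real CARD('k) * \<eta>"
    by (simp_all add: algebra_simps)
  show ?thesis
  proof (rule that[OF \<eta>(1)])
    fix y assume y: "y \<in> K - W" and hy: "\<And>i. h i y < \<eta>"
    have "(\<Sum>i\<in>UNIV. max 0 (h i y)) \<le> real CARD('k) * \<eta>"
      by (rule sum_bounded_above) (use hy \<eta>(1) in \<open>auto simp: less_imp_le\<close>)
    then have "\<eta> \<le> max 0 (g y - g y0)"
      using z_le[OF y] \<eta>(2) unfolding \<phi>_def[of y] by linarith
    then show "g y0 + \<eta> \<le> g y"
      using \<eta>(1) by linarith
  qed
qed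

text \<open>Outside \<open>W\<close> a perturbed feasible point is nearly feasible, so by the gap
  its objective value exceeds that of a good Slater point.\<close>

lemma eventually_perturbed_min_near:
  assumes "\<forall>\<^sub>F y in nhds y0. P y"
  shows "\<forall>\<^sub>F e in at_right 0. \<forall>s r y. perturbation e s r \<longrightarrow> perturbed_min s r y \<longrightarrow> P y"
proof -
  obtain W where W: "open W" "y0 \<in> W" "\<And>y. y \<in> W \<Longrightarrow> P y"
    using assms unfolding eventually_nhds by blast
  obtain \<eta> where \<eta>: "0 < \<eta>" "\<And>y. y \<in> K - W \<Longrightarrow> (\<And>i. h i y < \<eta>) \<Longrightarrow> g y0 + \<eta> \<le> g y"
    using uniform_gap[OF W(1,2)] by blast
  obtain p where p: "p \<in> K" "\<And>i. h i p < 0" "g p < g y0 + \<eta> / 2"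
    using slater[of "\<eta> / 2"] \<eta>(1) by auto
  \<comment> \<open>Comparing \<open>y\<close> with \<open>p\<close> costs \<open>e\<close> twice,
    at either point once, and \<open>p\<close> already uses \<open>\<eta> / 2\<close>; hence
    \<open>2 * e < \<eta> / 2\<close>.\<close>
  have "\<forall>\<^sub>F e in at_right 0. e * 4 < \<eta>"
    using \<eta>(1) by (rule eventually_less_at_right_0)
  moreover have "\<forall>\<^sub>F e in at_right 0. \<forall>i. e * 1 < - h i p"
    using p(2) by (intro eventually_all_finite eventually_less_at_right_0) simp
  ultimately show ?thesis
  proof eventually_elim
    case (elim e)
    show ?case
    proof (intro allI impI)
      fix s r y assume pert: "perturbation e s r" and y: "perturbed_min s r y"
      have yK: "y \<in> K" and hy: "h i y + r i y \<le> 0" for i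
        using y by (auto simp: perturbed_min_def perturbed_feasible_def)
      have "h i p + r i p \<le> 0" for i
        using r_abs[OF pert p(1), of i] elim(2)[rule_format, of i] by linarith
      then have "g y + s y \<le> g p + s p"
        using y p(1) by (auto simp: perturbed_min_def perturbed_feasible_def)
      then have "g y < g y0 + \<eta>"
        using s_abs[OF pert p(1)] s_abs[OF pert yK] elim(1) p(3) by linarith
      moreover have "h i y < \<eta>" for i
        using hy[of i] r_abs[OF pert yK, of i] elim(1) \<eta>(1) by linarith
      ultimately have "y \<in> W"
        using \<eta>(2)[of y] yK by force
      then show "P y" by (rule W(3))
    qed
  qed
qed

text \<open>As \<open>e\<close> tends to zero, perturbed minimizers tend to \<open>y0\<close>
  uniformly in \<open>s\<close> and \<open>r\<close>. A joint condition valid near \<open>y0\<close>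
  for small \<open>e\<close> may thus be evaluated at the minimizer with the same
  \<open>e\<close>.\<close>

lemma eventually_perturbed_min_near_prod:
  assumes "\<forall>\<^sub>F p in nhds y0 \<times>\<^sub>F at_right 0. P (fst p) (snd p)"
  shows "\<forall>\<^sub>F e in at_right 0. \<forall>s r y. perturbation e s r \<longrightarrow> perturbed_min s r y \<longrightarrow> P y e"
proof -
  obtain Q R where Q: "\<forall>\<^sub>F y in nhds y0. Q y" and R: "\<forall>\<^sub>F e in at_right 0. R e"
    and QR: "\<And>y e. Q y \<Longrightarrow> R e \<Longrightarrow> P y e"
    using assms unfolding eventually_prod_filter by auto
  from eventually_perturbed_min_near[OF Q] R show ?thesis
    by eventually_elim (use QR in blast)
qed

section \<open>Stability of the active set\<close>

lemma eventually_prod_less: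
  assumes "isCont f y0" "f y0 < (c::real)"
  shows "\<forall>\<^sub>F p in nhds y0 \<times>\<^sub>F at_right 0. f (fst p) + snd p * b < c"
proof -
  have "((\<lambda>p. f (fst p) + snd p * b) \<longlongrightarrow> f y0 + 0 * b) (nhds y0 \<times>\<^sub>F at_right 0)"
  proof (intro tendsto_intros)
    have "filterlim fst (nhds y0) (nhds y0 \<times>\<^sub>F at_right (0::real))"
      by (rule filterlim_fst)
    then show "((\<lambda>p. f (fst p)) \<longlongrightarrow> f y0) (nhds y0 \<times>\<^sub>F at_right (0::real))"
      using assms(1) by (rule isCont_tendsto_compose[rotated])
    show "(snd \<longlongrightarrow> 0) (nhds y0 \<times>\<^sub>F at_right (0::real))"
      by (rule filterlim_mono[OF filterlim_snd at_within_le_nhds order_refl])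
  qed
  from order_tendstoD(2)[OF this, of c] assms(2) show ?thesis
    by simp
qed

lemma eventually_prod_inactive:
  "\<forall>\<^sub>F p in nhds y0 \<times>\<^sub>F at_right 0. \<forall>i. h i y0 \<noteq> 0 \<longrightarrow> h i (fst p) + snd p * 1 < 0"
proof (rule eventually_all_finite)
  fix i
  show "\<forall>\<^sub>F p in nhds y0 \<times>\<^sub>F at_right 0. h i y0 \<noteq> 0 \<longrightarrow> h i (fst p) + snd p * 1 < 0"
    using eventually_prod_less[of "h i" 0 1] feas[of i] h_isCont
    by (cases "h i y0 = 0") (auto elim: eventually_mono)
qed

text \<open>Inactive constraints keep a margin above \<open>e\<close>. For an active
  \<open>j\<close>, the property \<open>release\<close> says nothing about the rate of
  \<open>h j\<close>; this is harmless exactly when \<open>j\<close> is slack at the perturbed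
  minimizer, since a short step then cannot violate it.\<close>

lemma eventually_perturbed_min_active:
  "\<forall>\<^sub>F e in at_right 0. \<forall>s r y. perturbation e s r \<longrightarrow> perturbed_min s r y \<longrightarrow>
     (\<forall>i. h i y + r i y = 0 \<longleftrightarrow> h i y0 = 0)"
proof -
  have "\<forall>\<^sub>F p in nhds y0 \<times>\<^sub>F at_right 0. \<forall>j. h j y0 = 0 \<longrightarrow>
      (\<exists>d. d \<bullet> gradient g (fst p) + snd p * norm d < 0 \<and>
        (\<forall>i. i \<noteq> j \<longrightarrow> h i y0 = 0 \<longrightarrow> d \<bullet> gradient (h i) (fst p) + snd p * norm d < 0))"
  proof (intro eventually_all_finite)
    fix j
    show "\<forall>\<^sub>F p in nhds y0 \<times>\<^sub>F at_right 0. h j y0 = 0 \<longrightarrow>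
      (\<exists>d. d \<bullet> gradient g (fst p) + snd p * norm d < 0 \<and>
        (\<forall>i. i \<noteq> j \<longrightarrow> h i y0 = 0 \<longrightarrow> d \<bullet> gradient (h i) (fst p) + snd p * norm d < 0))"
    proof (cases "h j y0 = 0")
      case True
      then obtain d where d: "d \<bullet> gradient g y0 < 0"
        "\<And>i. i \<noteq> j \<Longrightarrow> h i y0 = 0 \<Longrightarrow> d \<bullet> gradient (h i) y0 < 0"
        using release by blast
      have "\<forall>\<^sub>F p in nhds y0 \<times>\<^sub>F at_right 0. d \<bullet> gradient g (fst p) + snd p * norm d < 0"
        by (intro eventually_prod_less d(1) continuous_intros g_cont)
      moreover have "\<forall>\<^sub>F p in nhds y0 \<times>\<^sub>F at_right 0.
          \<forall>i. i \<noteq> j \<longrightarrow> h i y0 = 0 \<longrightarrow> d \<bullet> gradient (h i) (fst p) + snd p * norm d < 0"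
      proof (intro eventually_all_finite)
        fix i
        show "\<forall>\<^sub>F p in nhds y0 \<times>\<^sub>F at_right 0.
          i \<noteq> j \<longrightarrow> h i y0 = 0 \<longrightarrow> d \<bullet> gradient (h i) (fst p) + snd p * norm d < 0"
          using eventually_prod_less[of "\<lambda>y. d \<bullet> gradient (h i) y" 0 "norm d"]
            d(2)[of i] h_cont
          by (cases "i \<noteq> j \<and> h i y0 = 0") (auto intro!: continuous_intros elim: eventually_mono)
      qed
      ultimately show ?thesis
        by eventually_elim blast
    qed simp
  qed
  from eventually_perturbed_min_near_prod[OF this] eventually_perturbed_min_near_prod[OF eventually_prod_inactive]
    eventually_perturbed_min_near[OF eventually_nhds_in_open[OF open_interior K(2)]]
  show ?thesis
  proof eventually_elim
    case (elim e)
    show ?case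
    proof (intro allI impI)
      fix s r y j assume pert: "perturbation e s r" and y: "perturbed_min s r y"
      \<comment> \<open>Membership in \<open>K\<close> is a constraint of the perturbed problem too;
        at an interior point it does not obstruct short steps.\<close>
      have y_int: "y \<in> interior K"
        using elim(3) pert y by blast
      then have yK: "y \<in> K"
        using interior_subset by blast
      have hy: "h i y + r i y \<le> 0" for i
        using y by (auto simp: perturbed_min_def perturbed_feasible_def)
      have inactive: "h i y + r i y < 0" if "h i y0 \<noteq> 0" for i
        using elim(2)[rule_format, OF pert y that] r_abs[OF pert yK, of i] by linarith
      moreover have "h j y + r j y = 0" if j: "h j y0 = 0"
      proof (rule ccontr)
        assume nz: "h j y + r j y \<noteq> 0"
        obtain d where d: "d \<bullet> gradient g y + e * norm d < 0"
          "\<And>i. i \<noteq> j \<Longrightarrow> h i y0 = 0 \<Longrightarrow> d \<bullet> gradient (h i) y + e * norm d < 0"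
          using elim(1)[rule_format, OF pert y j] by blast
        have "d \<bullet> (gradient g y + gradient s y) < 0"
          using d(1) gs_gradient[OF pert yK, of d] by linarith
        from eventually_descent[OF gs_deriv[OF pert yK] this]
        have 1: "\<forall>\<^sub>F t in at_right 0. g (y + t *\<^sub>R d) + s (y + t *\<^sub>R d) < g y + s y" .
        \<comment> \<open>An index active at the perturbed point was active at \<open>y0\<close> by
          \<open>inactive\<close> and differs from \<open>j\<close> by \<open>nz\<close>, so
          \<open>d\<close> decreases its constraint.\<close>
        have "d \<bullet> (gradient (h i) y + gradient (r i) y) < 0" if "h i y + r i y = 0" for i
          using that nz inactive[of i] d(2)[of i] hr_gradient[OF pert yK, of d i] by fastforce
        from eventually_feasible_direction[OF hr_deriv[OF pert yK] hy this]
        have 2: "\<forall>\<^sub>F t in at_right 0. \<forall>i. h i (y + t *\<^sub>R d) + r i (y + t *\<^sub>R d) < 0" .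
        have "((\<lambda>t. y + t *\<^sub>R d) \<longlongrightarrow> y) (at_right 0)"
          by (auto intro!: tendsto_eq_intros)
        then have 3: "\<forall>\<^sub>F t in at_right 0. y + t *\<^sub>R d \<in> interior K"
          using y_int by (rule topological_tendstoD[OF _ open_interior])
        have "\<forall>\<^sub>F t in at_right (0::real). False"
          using 1 2 3
        proof eventually_elim
          case (elim t)
          then have "y + t *\<^sub>R d \<in> perturbed_feasible r"
            using interior_subset by (auto simp: perturbed_feasible_def less_imp_le)
          with elim(1) y show False
            by (force simp: perturbed_min_def)
        qed
        then show False
          by simp
      qed
      ultimately show "h j y + r j y = 0 \<longleftrightarrow> h j y0 = 0"
        by force
    qed
  qed
qed

section \<open>Uniqueness of the perturbed minimizer\<close>

text \<open>
  The midpoint of two perturbed minimizers beats both of them by a multiple of their squared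
  distance, and violates the constraints by at most \<open>e\<close> times it; a step of that length along an
  inward direction restores feasibility.
\<close>

lemma eventually_perturbed_min_unique:
  "\<forall>\<^sub>F e in at_right 0. \<forall>s r y z. perturbation e s r \<longrightarrow>
     perturbed_min s r y \<longrightarrow> perturbed_min s r z \<longrightarrow> y = z"
proof -
  obtain d0 where d0: "\<And>i. h i y0 = 0 \<Longrightarrow> d0 \<bullet> gradient (h i) y0 < 0"
    using inward by blast
  \<comment> \<open>The inward direction is scaled to rates below \<open>- 1\<close>, so that a step
    of length parameter \<open>t\<close> lowers each active constraint by at least \<open>t\<close>,
    the very amount by which the midpoint may violate it.\<close>
  obtain d where d: "\<And>i. h i y0 = 0 \<Longrightarrow> d \<bullet> gradient (h i) y0 < - 1"
  proof -
    have "\<forall>\<^sub>F t in at_top. \<forall>i. h i y0 = 0 \<longrightarrow> (t *\<^sub>R d0) \<bullet> gradient (h i) y0 < - 1"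
    proof (rule eventually_all_finite)
      fix i
      show "\<forall>\<^sub>F t in at_top. h i y0 = 0 \<longrightarrow> (t *\<^sub>R d0) \<bullet> gradient (h i) y0 < - 1"
      proof (cases "h i y0 = 0")
        case True
        show ?thesis
          using eventually_gt_at_top[of "- 1 / (d0 \<bullet> gradient (h i) y0)"]
          by (rule eventually_mono) (use neg_divide_less_eq[OF d0[OF True], of "- 1"] in simp)
      qed simp
    qed
    then show ?thesis
      using that eventually_happens'[of "at_top :: real filter"] by fastforce
  qed
  \<comment> \<open>\<open>C\<close> bounds the rate at which the perturbed objective can rise along
    \<open>d\<close> near \<open>y0\<close>; the added \<open>1\<close> makes the bound strict and
    thus stable.\<close>
  define C where "C = \<bar>d \<bullet> gradient g y0\<bar> + 1"
  have C: "0 < C" "d \<bullet> gradient g y0 < C" by (auto simp: C_def)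
  have "\<forall>\<^sub>F p in nhds y0 \<times>\<^sub>F at_right 0. d \<bullet> gradient g (fst p) + snd p * norm d < C"
    by (intro eventually_prod_less C continuous_intros g_cont)
  moreover have "\<forall>\<^sub>F p in nhds y0 \<times>\<^sub>F at_right 0.
      \<forall>i. h i y0 = 0 \<longrightarrow> d \<bullet> gradient (h i) (fst p) + snd p * norm d < - 1"
  proof (rule eventually_all_finite)
    fix i
    show "\<forall>\<^sub>F p in nhds y0 \<times>\<^sub>F at_right 0.
        h i y0 = 0 \<longrightarrow> d \<bullet> gradient (h i) (fst p) + snd p * norm d < - 1"
      using eventually_prod_less[of "\<lambda>y. d \<bullet> gradient (h i) y" "-1" "norm d"]
        d[of i] h_cont
      by (cases "h i y0 = 0") (auto intro!: continuous_intros elim: eventually_mono)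
  qed
  moreover note eventually_prod_inactive
  ultimately have "\<forall>\<^sub>F p in nhds y0 \<times>\<^sub>F at_right 0. d \<bullet> gradient g (fst p) + snd p * norm d < C \<and>
      (\<forall>i. h i y0 = 0 \<longrightarrow> d \<bullet> gradient (h i) (fst p) + snd p * norm d < - 1) \<and>
      (\<forall>i. h i y0 \<noteq> 0 \<longrightarrow> h i (fst p) + snd p * 1 < 0)"
    by eventually_elim blast
  \<comment> \<open>The estimates are needed along a whole segment for one \<open>e\<close>, beyond
    the minimizers themselves. Splitting the product filter yields a neighborhood of
    \<open>y0\<close> that does not depend on \<open>e\<close>.\<close>
  then obtain Q R where Q: "\<forall>\<^sub>F y in nhds y0. Q y" and R: "\<forall>\<^sub>F e in at_right 0. R e"
    and QR: "\<And>y e. Q y \<Longrightarrow> R e \<Longrightarrow> d \<bullet> gradient g y + e * norm d < C \<and>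
      (\<forall>i. h i y0 = 0 \<longrightarrow> d \<bullet> gradient (h i) y + e * norm d < - 1) \<and>
      (\<forall>i. h i y0 \<noteq> 0 \<longrightarrow> h i y + e * 1 < 0)"
    unfolding eventually_prod_filter by auto
  from eventually_conj[OF Q eventually_nhds_in_open[OF open_interior K(2)]]
  obtain \<rho> where \<rho>: "0 < \<rho>" "\<And>y. dist y y0 < \<rho> \<Longrightarrow> Q y \<and> y \<in> interior K"
    unfolding eventually_nhds_metric by blast
  have ball: "ball y0 \<rho> \<subseteq> K"
    using \<rho>(2) interior_subset by (force simp: dist_commute)
  \<comment> \<open>Half of the radius holds the two minimizers and their midpoint; the other half
    is reserved for the corrective step, which the fourth condition below keeps short enough because
    \<open>v < \<rho>\<close>.\<close>
  have "\<forall>\<^sub>F y in nhds y0. dist y y0 < \<rho> / 2"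
    unfolding eventually_nhds_metric using \<rho>(1) by (intro exI[of _ "\<rho> / 2"]) simp
  from eventually_perturbed_min_near[OF this] R
    eventually_less_at_right_0[OF \<mu>, of "1 + C"]
    eventually_less_at_right_0[OF half_gt_zero[OF \<rho>(1)], of "\<rho>\<^sup>2 * norm d"]
    eventually_at_right_less[of "0::real"]
  show ?thesis
  proof eventually_elim
    case (elim e)
    show ?case
    proof (intro allI impI, rule ccontr)
      fix s r y z
      assume pert: "perturbation e s r" and y: "perturbed_min s r y" and z: "perturbed_min s r z"
        and "y \<noteq> z"
      have y_near: "dist y y0 < \<rho> / 2" and z_near: "dist z y0 < \<rho> / 2"
        using elim(1) pert y z by blast+
      define v where "v = dist y z"
      define m where "m = midpoint y z"
      \<comment> \<open>This is the midpoint defect of each perturbation. It is paid once for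
        \<open>s\<close> and, through the corrective step, \<open>C\<close> times more; the bound
        \<open>e * (1 + C) < \<mu>\<close> makes the total smaller than the gain
        \<open>\<mu> * v\<^sup>2\<close>.\<close>
      define t where "t = e * v\<^sup>2"
      have v: "0 < v" "v < \<rho>"
        using \<open>y \<noteq> z\<close> y_near z_near dist_triangle_half_l[of y y0 \<rho> z] by (auto simp: v_def)
      have t: "0 < t"
        using v(1) elim(5) by (simp add: t_def)
      have yz_ball: "y \<in> ball y0 (\<rho> / 2)" "z \<in> ball y0 (\<rho> / 2)"
        using y_near z_near by (auto simp: dist_commute)
      then have m_ball: "m \<in> ball y0 (\<rho> / 2)"
        using midpoint_in_closed_segment[of y z] convex_ball[of y0 "\<rho> / 2"]
        unfolding m_def convex_contains_segment by blast
      have "t * norm d \<le> e * (\<rho>\<^sup>2 * norm d)"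
        using v elim(5) by (auto simp: t_def mult.assoc intro!: mult_mono power_mono)
      then have td: "norm (t *\<^sub>R d) < \<rho> / 2"
        using elim(4) t \<rho>(1) by simp
      have seg: "m + u *\<^sub>R (t *\<^sub>R d) \<in> ball y0 \<rho>" if "0 \<le> u" "u \<le> 1" for u
      proof -
        have "norm (u *\<^sub>R (t *\<^sub>R d)) \<le> norm (t *\<^sub>R d)"
          using that mult_left_le_one_le[of "norm (t *\<^sub>R d)" u]
          by (simp add: abs_mult mult.assoc)
        with td m_ball show ?thesis
          using norm_triangle_ineq4[of "y0 - m" "u *\<^sub>R (t *\<^sub>R d)"]
          by (simp add: dist_norm algebra_simps)
      qed
      have mid: "p m \<le> (p y + p z) / 2 + t" if "small_perturbation K e p" for p
      proof -
        have "y \<in> ball y0 \<rho>" "z \<in> ball y0 \<rho>"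
          using yz_ball \<rho>(1) by auto
        with that ball show ?thesis
          unfolding small_perturbation_def m_def t_def v_def using convex_ball by blast
      qed
      have segK: "m + u *\<^sub>R (t *\<^sub>R d) \<in> K" if "0 \<le> u" "u \<le> 1" for u
        using seg[OF that] ball by blast
      have segQ: "Q (m + u *\<^sub>R (t *\<^sub>R d))" if "0 \<le> u" "u \<le> 1" for u
        using seg[OF that] \<rho>(2) by (simp add: dist_commute)
      define w where "w = m + t *\<^sub>R d"
      have wK: "w \<in> K" and wQ: "Q w"
        using segK[of 1] segQ[of 1] by (auto simp: w_def)
      have hy: "h i y + r i y \<le> 0" and hz: "h i z + r i z \<le> 0" for i
        using y z by (auto simp: perturbed_min_def perturbed_feasible_def)
      have "h i w + r i w \<le> 0" for i
      proof (cases "h i y0 = 0")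
        case True
        obtain u where u: "u \<in> {0..1}" "(h i w + r i w) - (h i m + r i m) =
            (t *\<^sub>R d) \<bullet> (gradient (h i) (m + u *\<^sub>R (t *\<^sub>R d)) + gradient (r i) (m + u *\<^sub>R (t *\<^sub>R d)))"
          using mvt_GDERIV[of "\<lambda>y. h i y + r i y" m "t *\<^sub>R d" "\<lambda>y. gradient (h i) y + gradient (r i) y"]
            hr_deriv[OF pert segK] unfolding w_def by blast
        have "d \<bullet> (gradient (h i) (m + u *\<^sub>R (t *\<^sub>R d)) + gradient (r i) (m + u *\<^sub>R (t *\<^sub>R d))) \<le> - 1"
          using hr_gradient[OF pert segK, of u d i] QR[OF segQ elim(2), of u] True u(1) by fastforce
        from mult_left_mono[OF this less_imp_le[OF t]]
        have "(h i w + r i w) \<le> (h i m + r i m) - t"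
          using u(2) by simp
        moreover have "h i m \<le> (h i y + h i z) / 2"
          unfolding m_def by (rule h_midpoint)
        moreover have "r i m \<le> (r i y + r i z) / 2 + t"
          using mid pert by (simp add: perturbation_def)
        ultimately show ?thesis
          using hy[of i] hz[of i] by argo
      next
        case False
        then show ?thesis
          using QR[OF wQ elim(2)] r_abs[OF pert wK, of i] by fastforce
      qed
      then have "w \<in> perturbed_feasible r"
        using wK by (simp add: perturbed_feasible_def)
      then have le: "g y + s y \<le> g w + s w" "g z + s z \<le> g w + s w"
        using y z by (auto simp: perturbed_min_def)
      obtain u where u: "u \<in> {0..1}" "(g w + s w) - (g m + s m) =
          (t *\<^sub>R d) \<bullet> (gradient g (m + u *\<^sub>R (t *\<^sub>R d)) + gradient s (m + u *\<^sub>R (t *\<^sub>R d)))"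
        using mvt_GDERIV[of "\<lambda>y. g y + s y" m "t *\<^sub>R d" "\<lambda>y. gradient g y + gradient s y"]
          gs_deriv[OF pert segK] unfolding w_def by blast
      have "d \<bullet> (gradient g (m + u *\<^sub>R (t *\<^sub>R d)) + gradient s (m + u *\<^sub>R (t *\<^sub>R d))) \<le> C"
        using gs_gradient[OF pert segK, of u d] QR[OF segQ elim(2), of u] u(1) by fastforce
      from mult_left_mono[OF this less_imp_le[OF t]]
      have "(g w + s w) \<le> (g m + s m) + t * C"
        using u(2) by simp
      moreover have "g m \<le> (g y + g z) / 2 - \<mu> * v\<^sup>2"
        unfolding m_def v_def by (rule g_midpoint)
      moreover have "s m \<le> (s y + s z) / 2 + t"
        using mid pert by (simp add: perturbation_def)
      ultimately have "\<mu> * v\<^sup>2 \<le> t + t * C"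
        using le by argo
      also have "\<dots> = (e * (1 + C)) * v\<^sup>2"
        by (simp add: t_def algebra_simps)
      also have "\<dots> < \<mu> * v\<^sup>2"
        using elim(3) v(1) by (intro mult_strict_right_mono) auto
      finally show False by simp
    qed
  qed
qed

end

section \<open>From convexity, LICQ and SCSC to the abstract problem\<close>

lemma strongly_convex_midpoint:
  assumes "strongly_convex f"
  obtains \<mu> where "0 < \<mu>" "\<And>y z. f (midpoint y z) \<le> (f y + f z) / 2 - \<mu> * (dist y z)\<^sup>2"
proof -
  obtain \<mu> where \<mu>: "0 < \<mu>" "\<forall>y z. \<forall>t\<in>{0..1}. f ((1 - t) *\<^sub>R y + t *\<^sub>R z)
      \<le> (1 - t) * f y + t * f z - \<mu> / 2 * t * (1 - t) * (norm (y - z))\<^sup>2"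
    using assms unfolding strongly_convex_def by blast
  show ?thesis
  \<comment> \<open>At \<open>t = 1/2\<close> the modulus term is
    \<open>\<mu> / 2 * 1/2 * 1/2\<close>.\<close>
  proof (rule that[of "\<mu> / 8"])
    show "f (midpoint y z) \<le> (f y + f z) / 2 - \<mu> / 8 * (dist y z)\<^sup>2" for y z
      using \<mu>(2)[rule_format, of "1/2" y z]
      by (simp add: midpoint_def dist_norm scaleR_add_right add_divide_distrib)
  qed (use \<mu>(1) in simp)
qed

lemma convex_on_midpoint:
  assumes "convex_on UNIV f"
  shows "f (midpoint y z) \<le> (f y + f z) / 2"
  using convex_onD[OF assms, of "1/2" y z] by (simp add: midpoint_def scaleR_add_right)

text \<open>The one place where multipliers of the unperturbed problem occur: LICQ produces a KKT
  pair at \<open>y0\<close>, SCSC makes its active multipliers positive, and each of these is turned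
  into a release direction.\<close>

lemma nondegenerate_problemI:
  fixes g :: "'x \<Rightarrow> 'a::euclidean_space \<Rightarrow> real" and h :: "'k::finite \<Rightarrow> 'x \<Rightarrow> 'a \<Rightarrow> real"
  assumes g: "\<And>y. GDERIV (g x) y :> gradient (g x) y" "\<And>y. isCont (gradient (g x)) y"
    and h: "\<And>i y. GDERIV (h i x) y :> gradient (h i x) y" "\<And>i y. isCont (gradient (h i x)) y"
    and \<mu>: "0 < \<mu>" "\<And>y z. g x (midpoint y z) \<le> (g x y + g x z) / 2 - \<mu> * (dist y z)\<^sup>2"
    and h_mid: "\<And>i y z. h i x (midpoint y z) \<le> (h i x y + h i x z) / 2"
    and y0: "y0 \<in> feasible h x"
    and min: "\<And>z. z \<in> feasible h x \<Longrightarrow> z \<noteq> y0 \<Longrightarrow> g x y0 < g x z"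
    and LICQ: "LICQ h x" and SCSC: "SCSC g h x"
    and K: "compact K" "y0 \<in> interior K"
  shows "nondegenerate_problem (g x) (\<lambda>i. h i x) y0 \<mu> K"
proof -
  define E where "E i = gradient (h i x) y0" for i
  have indep: "inj_on E {i. h i x y0 = 0}" "independent (E ` {i. h i x y0 = 0})"
    using LICQ y0 unfolding LICQ_def active_def E_def by blast+
  have feas: "h i x y0 \<le> 0" for i
    using y0 by (simp add: feasible_def)
  have min_le: "g x y0 \<le> g x z" if "\<And>i. h i x z \<le> 0" for z
    using min[of z] that by (cases "z = y0") (auto simp: feasible_def less_imp_le)
  obtain l where l: "\<And>i. 0 \<le> l i" "\<And>i. h i x y0 \<noteq> 0 \<Longrightarrow> l i = 0"
    and stat: "gradient (g x) y0 + (\<Sum>i\<in>UNIV. l i *\<^sub>R E i) = 0"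
    using KKT_multipliers[of "g x" y0 _ "\<lambda>i. h i x" E, OF g(1) h(1)[of _ y0, folded E_def] feas min_le indep]
    by blast
  have "kkt_pair g h x y0 (\<chi> i. l i)"
    using l stat feas unfolding kkt_pair_def E_def by force
  from SCSC[unfolded SCSC_def, rule_format, OF this]
  have l_pos: "0 < l i" if "h i x y0 = 0" for i
    using that by (metis less_irrefl vec_lambda_beta)
  show ?thesis
  proof
    show "\<exists>d. \<forall>i. h i x y0 = 0 \<longrightarrow> d \<bullet> gradient (h i x) y0 < 0"
    proof -
      obtain d where "\<forall>i\<in>{i. h i x y0 = 0}. d \<bullet> E i = - 1"
        using independent_family_prescribed_inner[OF indep, of "\<lambda>_. - 1"] by blast
      then show ?thesis
        by (intro exI[of _ d]) (simp add: E_def)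
    qed
    show "\<exists>d. d \<bullet> gradient (g x) y0 < 0 \<and>
        (\<forall>i. i \<noteq> j \<longrightarrow> h i x y0 = 0 \<longrightarrow> d \<bullet> gradient (h i x) y0 < 0)" if "h j x y0 = 0" for j
      using release_direction[OF indep stat l(1), of j] l(2) l_pos[OF that] that
      unfolding E_def by auto
    show "g x y0 < g x z" if "\<And>i. h i x z \<le> 0" "z \<noteq> y0" for z
      using min that by (simp add: feasible_def)
  qed (use g h \<mu> h_mid feas K in auto)
qed

theorem theorem2p6:
  fixes X :: "(real ^ 'n) set"
    and g :: "real ^ 'n \<Rightarrow> real ^ 'm \<Rightarrow> real"
    and h :: "'k::finite \<Rightarrow> real ^ 'n \<Rightarrow> real ^ 'm \<Rightarrow> real"
    and x :: "real ^ 'n"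
  assumes "smooth_on (X \<times> UNIV) (\<lambda>(x, y). g x y)"
    and "\<And>i. smooth_on (X \<times> UNIV) (\<lambda>(x, y). h i x y)"
    and "\<And>x. x \<in> X \<Longrightarrow> feasible h x \<noteq> {}"
    and "x \<in> X"
    and "bounded (feasible h x)"
    and "\<And>i. convex_on UNIV (h i x)"
    and "strongly_convex (g x)"
    and "LICQ h x"
    and "SCSC g h x"
  shows "\<exists>ystar. unique_minimizer (g x) (feasible h x) ystar \<and>
    (\<forall>K\<^sub>i\<^sub>n K\<^sub>o\<^sub>u\<^sub>t :: (real ^ 'm) set.
       compact K\<^sub>i\<^sub>n \<and> compact K\<^sub>o\<^sub>u\<^sub>t \<and>
       feasible h x \<subseteq> interior K\<^sub>i\<^sub>n \<and> K\<^sub>i\<^sub>n \<subseteq> interior K\<^sub>o\<^sub>u\<^sub>t \<longrightarrow>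
       (\<exists>\<epsilon>>0. \<forall>(s :: real ^ 'n \<Rightarrow> real ^ 'm \<Rightarrow> real)
                 (r :: 'k \<Rightarrow> real ^ 'n \<Rightarrow> real ^ 'm \<Rightarrow> real).
          C2_near K\<^sub>o\<^sub>u\<^sub>t (s x) \<and> (\<forall>i. C2_near K\<^sub>o\<^sub>u\<^sub>t (r i x)) \<and>
          C2_norm K\<^sub>o\<^sub>u\<^sub>t (s x) + (MAX i. C2_norm K\<^sub>o\<^sub>u\<^sub>t (r i x)) \<le> \<epsilon> \<longrightarrow>
          (let g' = (\<lambda>x y. g x y + s x y);
               h' = (\<lambda>i x y. h i x y + r i x y)
           in \<exists>ytilde. unique_minimizer (g' x) (K\<^sub>i\<^sub>n \<inter> feasible h' x) ytilde \<and>
                active h' x ytilde = active h x ystar)))"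
proof -
  note g_smooth = smooth_on_slice[OF assms(1,4)]
  note h_smooth = smooth_on_slice[OF assms(2,4)]
  obtain \<mu> where \<mu>: "0 < \<mu>"
    "\<And>y z. g x (midpoint y z) \<le> (g x y + g x z) / 2 - \<mu> * (dist y z)\<^sup>2"
    using strongly_convex_midpoint[OF assms(7)] by blast
  note h_mid = convex_on_midpoint[OF assms(6)]
  have g_cont: "continuous_on S (g x)" and h_cont: "continuous_on S (h i x)" for S i
    using GDERIV_isCont[OF g_smooth(1)] GDERIV_isCont[OF h_smooth(1)]
    by (auto intro: continuous_at_imp_continuous_on)
  have "feasible h x = (\<Inter>i. {y. h i x y \<le> 0})"
    by (auto simp: feasible_def)
  also have "closed \<dots>"
    by (intro closed_INT ballI closed_Collect_le h_cont continuous_on_const)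
  finally have "compact (feasible h x)"
    using assms(5) by (simp add: compact_eq_bounded_closed)
  then obtain y0 where y0: "y0 \<in> feasible h x" and y0_le: "\<And>z. z \<in> feasible h x \<Longrightarrow> g x y0 \<le> g x z"
    using continuous_attains_inf[OF _ assms(3)[OF assms(4)] g_cont] by blast
  \<comment> \<open>The midpoint of \<open>y0\<close> and \<open>z\<close> is feasible, so its value
    is at least \<open>g x y0\<close>; the quadratic term of strong convexity then forces a positive
    gap.\<close>
  have y0_less: "g x y0 < g x z" if z: "z \<in> feasible h x" "z \<noteq> y0" for z
  proof -
    have "midpoint y0 z \<in> feasible h x"
      unfolding feasible_def
    proof (intro CollectI allI)
      show "h i x (midpoint y0 z) \<le> 0" for i
        using h_mid[of i y0 z] y0 z(1) by (simp add: feasible_def) (smt (verit) field_sum_of_halves)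
    qed
    from y0_le[OF this] have "\<mu> * (dist y0 z)\<^sup>2 \<le> (g x z - g x y0) / 2"
      using \<mu>(2)[of y0 z] by argo
    moreover have "0 < \<mu> * (dist y0 z)\<^sup>2"
      using \<mu>(1) z(2) by simp
    ultimately show ?thesis
      by argo
  qed
  have "unique_minimizer (g x) (feasible h x) y0"
    unfolding unique_minimizer_def is_arg_min_linorder using y0 y0_le y0_less by (meson leD)
  moreover have "\<exists>\<epsilon>>0. \<forall>(s :: real ^ 'n \<Rightarrow> real ^ 'm \<Rightarrow> real)
                 (r :: 'k \<Rightarrow> real ^ 'n \<Rightarrow> real ^ 'm \<Rightarrow> real).
          C2_near Ko (s x) \<and> (\<forall>i. C2_near Ko (r i x)) \<and>
          C2_norm Ko (s x) + (MAX i. C2_norm Ko (r i x)) \<le> \<epsilon> \<longrightarrow>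
          (\<exists>y. unique_minimizer (\<lambda>y. g x y + s x y)
              (Ki \<inter> feasible (\<lambda>i x y. h i x y + r i x y) x) y \<and>
            active (\<lambda>i x y. h i x y + r i x y) x y = active h x y0)"
    if Ki: "compact Ki" "feasible h x \<subseteq> interior Ki" and Ko: "compact Ko" "Ki \<subseteq> interior Ko"
    for Ki Ko :: "(real ^ 'm) set"
  proof -
    have y0_Ki: "y0 \<in> interior Ki"
      using y0 Ki(2) by blast
    have Ki_Ko: "Ki \<subseteq> Ko" and y0_Ko: "y0 \<in> Ko"
      using Ko(2) y0_Ki interior_subset by blast+
    \<comment> \<open>The compact set of the locale is the inner one, to which the perturbed problem
      is restricted; the C2 bounds on \<open>Ko\<close> pass to this subset in
      \<open>pert\<close>.\<close>
    interpret nondegenerate_problem "g x" "\<lambda>i. h i x" y0 \<mu> Ki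
      by (rule nondegenerate_problemI[OF g_smooth h_smooth \<mu> h_mid y0 y0_less assms(8,9) Ki(1) y0_Ki])
    have "\<forall>\<^sub>F e in at_right 0. 0 < e \<and>
        (\<forall>s r. perturbation e s r \<longrightarrow> (\<exists>y. perturbed_min s r y)) \<and>
        (\<forall>s r y z. perturbation e s r \<longrightarrow> perturbed_min s r y \<longrightarrow> perturbed_min s r z \<longrightarrow> y = z) \<and>
        (\<forall>s r y. perturbation e s r \<longrightarrow> perturbed_min s r y \<longrightarrow>
          (\<forall>i. h i x y + r i y = 0 \<longleftrightarrow> h i x y0 = 0))"
      by (intro eventually_conj eventually_at_right_less eventually_perturbed_min_exists
          eventually_perturbed_min_unique eventually_perturbed_min_active)
    from eventually_happens'[OF trivial_limit_at_right_real this]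
    obtain e :: real where "0 < e"
      and ex: "\<forall>s r. perturbation e s r \<longrightarrow> (\<exists>y. perturbed_min s r y)"
      and uniq: "\<forall>s r y z. perturbation e s r \<longrightarrow> perturbed_min s r y \<longrightarrow> perturbed_min s r z \<longrightarrow> y = z"
      and act: "\<forall>s r y. perturbation e s r \<longrightarrow> perturbed_min s r y \<longrightarrow>
          (\<forall>i. h i x y + r i y = 0 \<longleftrightarrow> h i x y0 = 0)"
      by (elim exE conjE)
    show ?thesis
    proof (intro exI[of _ e] conjI allI impI \<open>0 < e\<close>, elim conjE)
      fix s :: "real ^ 'n \<Rightarrow> real ^ 'm \<Rightarrow> real" and r :: "'k \<Rightarrow> real ^ 'n \<Rightarrow> real ^ 'm \<Rightarrow> real"
      assume s: "C2_near Ko (s x)" and r: "\<forall>i. C2_near Ko (r i x)"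
        and le: "C2_norm Ko (s x) + (MAX i. C2_norm Ko (r i x)) \<le> e"
      have r_le: "C2_norm Ko (r i x) \<le> (MAX i. C2_norm Ko (r i x))" for i
        by (intro Max_ge) auto
      \<comment> \<open>Only the sum of the norms is bounded by \<open>e\<close>. Nonnegativity of
        each norm, read off at the point \<open>y0\<close> of \<open>Ko\<close>, lets the bound pass
        to the single terms.\<close>
      have s_pos: "0 \<le> C2_norm Ko (s x)"
        using abs_le_C2_norm[OF s Ko(1) y0_Ko] by linarith
      have r_pos: "0 \<le> C2_norm Ko (r i x)" for i
        using abs_le_C2_norm[OF r[rule_format] Ko(1) y0_Ko, of i] by linarith
      have "C2_norm Ko (s x) \<le> e" "C2_norm Ko (r i x) \<le> e" for i
        using le s_pos r_pos[of i] r_le[of i] by linarith+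
      then have pert: "perturbation e (s x) (\<lambda>i. r i x)"
        unfolding perturbation_def using s r Ko(1) Ki_Ko
        by (auto intro!: small_perturbation_subset[OF small_perturbation_C2 Ki_Ko])
      have min_iff: "is_arg_min (\<lambda>y. g x y + s x y)
          (\<lambda>z. z \<in> Ki \<inter> feasible (\<lambda>i x y. h i x y + r i x y) x) y \<longleftrightarrow>
          perturbed_min (s x) (\<lambda>i. r i x) y" for y
        unfolding is_arg_min_linorder perturbed_min_def perturbed_feasible_def feasible_def by auto
      obtain y where y: "perturbed_min (s x) (\<lambda>i. r i x) y"
        using ex pert by blast
      have "unique_minimizer (\<lambda>y. g x y + s x y)
              (Ki \<inter> feasible (\<lambda>i x y. h i x y + r i x y) x) y"
        unfolding unique_minimizer_def min_iff using y uniq pert by blast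
      moreover have "active (\<lambda>i x y. h i x y + r i x y) x y = active h x y0"
        using act[rule_format, OF pert y] by (simp add: active_def)
      ultimately show "\<exists>y. unique_minimizer (\<lambda>y. g x y + s x y)
              (Ki \<inter> feasible (\<lambda>i x y. h i x y + r i x y) x) y \<and>
            active (\<lambda>i x y. h i x y + r i x y) x y = active h x y0"
        by blast
    qed
  qed
  ultimately show ?thesis
    unfolding Let_def by (intro exI[of _ y0] conjI allI impI) auto
qed

end
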